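(* Let $E$ be a Euclidean space, $Z\in E$ a random vector and $\Lambda_1,\dots,\Lambda_n:E\to\mathbb R_+$ continuous. Assume there are $\alpha,\beta_1,\dots,\beta_n\in\mathcal M_{\mathbb P_+}$ such that for every $1$-Lipschitz and convex $f:E\to\mathbb R$ and every independent copy $Z'$ of $Z$, $$S_{|f(Z)-f(Z')|}\le\alpha\qquad\text{and}\qquad \forall k\in\{1,\dots,n\}:\ S_{\Lambda_k(Z)}\le\beta_k.$$ If $\Phi:E\to\mathbb R$ is convex and satisfies, for all $z,z'\in E$, $$|\Phi(z)-\Phi(z')|\le\max(\Lambda_1(z),\Lambda_1(z'))\cdots\max(\Lambda_n(z),\Lambda_n(z'))\cdot\|z-z'\|,$$ then $$S_{|\Phi(Z)-\Phi(Z')|}\le(2n+1)\cdot\alpha\boxtimes\beta_1\boxtimes\cdots\boxtimes\beta_n.$$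
   Context: Operators. An operator is a map $f:\mathbb R\to2^{\mathbb R}$, with graph $\{(x,y):y\in f(x)\}$, $\mathrm{Dom}(f)=\{x:f(x)\ne\emptyset\}$, $\mathrm{Ran}(f)=\bigcup_xf(x)$; its inverse is defined by $x\in f^{-1}(y)\iff y\in f(x)$. Products are pointwise Minkowski products: $(f\cdot g)(x)=\{ab:a\in f(x),b\in g(x)\}$; for $\lambda\in\mathbb R$, $(\lambda f)(x)=\{\lambda y:y\in f(x)\}$. The parallel product is $f\boxtimes g=(f^{-1}\cdot g^{-1})^{-1}$ (commutative, associative). Monotonicity. $f$ is nondecreasing if $(y-x)(v-u)\ge0$ for all $(x,u),(y,v)$ in its graph; nonincreasing if $-f$ is nondecreasing. A monotone (nondecreasing or nonincreasing) operator is maximally monotone if its graph is not strictly contained in that of another monotone operator. $\mathcal M_\downarrow$ is the set of maximally monotone nonincreasing operators. Order on $\mathcal M_\downarrow$. The resolvent of $f\in\mathcal M_\downarrow$ is $J_f=(\mathrm{Id}-f)^{-1}$, a single-valued function defined on all of $\mathbb R$; for $f,g\in\mathcal M_\downarrow$, $f\le g$ means $J_f(x)\le J_g(x)$ for all $x\in\mathbb R$. Probabilistic operators. $\mathcal M_{\mathbb P_+}$ is the set of $\alpha\in\mathcal M_\downarrow$ with $\mathrm{Dom}(\alpha)\subset\mathbb R_+$, $\mathrm{Ran}(\alpha)\subset\mathbb R_+$, and such that $\mathrm{Ran}(\alpha)$ contains a (strictly) increasing sequence converging to $1$. For a real random variable $X$, $S_X(t)=[\mathbb P(X>t),\mathbb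 P(X\ge t)]$, $t\in\mathbb R$; $S_X\in\mathcal M_\downarrow$. For $\gamma\in\mathcal M_\downarrow$ with $\mathrm{Dom}(\gamma),\mathrm{Ran}(\gamma)\subset\mathbb R_+$, $S_X\le\gamma$ is equivalent to: $\mathbb P(X>t)\le u$ for all $t\in\mathrm{Dom}(\gamma)$ and all $u\in\gamma(t)$. If in a degenerate case the right-hand side of the conclusion is not maximally monotone, the inequality is read in this latter form. *)

theory Defs
  imports "HOL-Probability.Probability"
begin

type_synonym operator = "real \<Rightarrow> real set"

definition op_graph :: "operator \<Rightarrow> (real \<times> real) set" where
  "op_graph f = {(x, y). y \<in> f x}"

definition op_Dom :: "operator \<Rightarrow> real set" where
  "op_Dom f = {x. f x \<noteq> {}}"

definition op_Ran :: "operator \<Rightarrow> real set" where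
  "op_Ran f = (\<Union>x. f x)"

definition op_inv :: "operator \<Rightarrow> operator" where
  "op_inv f y = {x. y \<in> f x}"

definition op_prod :: "operator \<Rightarrow> operator \<Rightarrow> operator" where
  "op_prod f g x = {a * b | a b. a \<in> f x \<and> b \<in> g x}"

text \<open>The scalar acts on the values of the operator, not on its argument.\<close>

definition op_scale :: "real \<Rightarrow> operator \<Rightarrow> operator" where
  "op_scale c f x = {c * y | y. y \<in> f x}"

definition par_prod :: "operator \<Rightarrow> operator \<Rightarrow> operator" where
  "par_prod f g = op_inv (op_prod (op_inv f) (op_inv g))"

definition nondecreasing_op :: "operator \<Rightarrow> bool" where
  "nondecreasing_op f \<longleftrightarrow>
     (\<forall>(x, u) \<in> op_graph f. \<forall>(y, v) \<in> op_graph f. (y - x) * (v - u) \<ge> 0)"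

definition nonincreasing_op :: "operator \<Rightarrow> bool" where
  "nonincreasing_op f \<longleftrightarrow> nondecreasing_op (op_scale (- 1) f)"

definition monotone_op :: "operator \<Rightarrow> bool" where
  "monotone_op f \<longleftrightarrow> nondecreasing_op f \<or> nonincreasing_op f"

definition maximally_monotone_op :: "operator \<Rightarrow> bool" where
  "maximally_monotone_op f \<longleftrightarrow>
     monotone_op f \<and> \<not> (\<exists>g. monotone_op g \<and> op_graph f \<subset> op_graph g)"

definition M_down :: "operator set" where
  "M_down = {f. maximally_monotone_op f \<and> nonincreasing_op f}"

definition resolvent_op :: "operator \<Rightarrow> operator" where
  "resolvent_op f = op_inv (\<lambda>x. {x - y | y. y \<in> f x})"

text \<open>For \<open>f \<in> M_down\<close> the set \<open>resolvent_op f x\<close> is a singleton for every real \<open>x\<close>; the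
  function below and the order \<open>op_le\<close> are meaningful only for such operators.\<close>

definition resolvent :: "operator \<Rightarrow> real \<Rightarrow> real" where
  "resolvent f x = the_elem (resolvent_op f x)"

definition op_le :: "operator \<Rightarrow> operator \<Rightarrow> bool" where
  "op_le f g \<longleftrightarrow> (\<forall>x. resolvent f x \<le> resolvent g x)"

definition M_prob :: "operator set" where
  "M_prob = {\<alpha> \<in> M_down. op_Dom \<alpha> \<subseteq> {0..} \<and> op_Ran \<alpha> \<subseteq> {0..} \<and>
     (\<exists>s :: nat \<Rightarrow> real. strict_mono s \<and> range s \<subseteq> op_Ran \<alpha> \<and> s \<longlonglongrightarrow> 1)}"

definition survival_op :: "'w measure \<Rightarrow> ('w \<Rightarrow> real) \<Rightarrow> operator" where
  "survival_op M X t =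
     {measure M {\<omega> \<in> space M. X \<omega> > t} .. measure M {\<omega> \<in> space M. X \<omega> \<ge> t}}"

definition independent_copy ::
  "'w measure \<Rightarrow> ('w \<Rightarrow> 'e::euclidean_space) \<Rightarrow> ('w \<Rightarrow> 'e) \<Rightarrow> bool" where
  "independent_copy M Z Z' \<longleftrightarrow>
     Z' \<in> borel_measurable M \<and> distr M borel Z' = distr M borel Z \<and>
     prob_space.indep_var M borel Z borel Z'"

text \<open>The reading of \<open>survival_op M X \<le> \<gamma>\<close>. For maximally monotone \<open>\<gamma>\<close> it is the resolvent order;
  otherwise it is the tail inequality, which is equivalent to the resolvent order when
  \<open>\<gamma> \<in> M_down\<close> has domain and range in the nonnegative reals.\<close>

definition survival_le :: "'w measure \<Rightarrow> ('w \<Rightarrow> real) \<Rightarrow> operator \<Rightarrow> bool" where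
  "survival_le M X \<gamma> \<longleftrightarrow>
     (if \<gamma> \<in> M_down then op_le (survival_op M X) \<gamma>
      else \<forall>t \<in> op_Dom \<gamma>. \<forall>u \<in> \<gamma> t. measure M {\<omega> \<in> space M. X \<omega> > t} \<le> u)"

end

theory Submission
  imports Defs
begin

text \<open>In terms of tails, the claim is \<open>P(\<bar>\<Phi>(Z) - \<Phi>(Z')\<bar> > a b\<^sub>1 \<dots> b\<^sub>n) \<le> (2n + 1) u\<close>
  whenever \<open>u \<in> \<alpha>(a)\<close> and \<open>u \<in> \<beta>\<^sub>k(b\<^sub>k)\<close> for all \<open>k\<close>. Put \<open>L = b\<^sub>1 \<dots> b\<^sub>n\<close> and
  \<open>C = {z. \<forall>k. \<Lambda>\<^sub>k(z) \<le> b\<^sub>k}\<close>. At a point \<open>z \<in> C\<close> the slope of \<open>\<Phi>\<close> is at most \<open>L\<close>, because the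
  \<open>\<Lambda>\<^sub>k\<close> are continuous, so by convexity \<open>\<Phi>(w) \<ge> \<Phi>(z) - L \<parallel>w - z\<parallel>\<close> for every \<open>w\<close>. The infimal
  convolution of \<open>\<Phi>\<close> with \<open>L \<parallel>\<cdot>\<parallel>\<close> is therefore a convex \<open>L\<close>-Lipschitz function that equals \<open>\<Phi>\<close>
  on \<open>C\<close>, although \<open>C\<close> need not be convex. A union bound over the event on which this function
  deviates and the \<open>2n\<close> events on which \<open>Z\<close> or \<open>Z'\<close> violates a constraint defining \<open>C\<close> concludes.\<close>

section \<open>Monotone operators and their resolvents\<close>

lemma nonincreasing_op_iff:
  "nonincreasing_op f \<longleftrightarrow> (\<forall>x y. \<forall>u\<in>f x. \<forall>v\<in>f y. (y - x) * (v - u) \<le> 0)"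
proof -
  have graph: "(\<forall>p\<in>op_graph g. P p) \<longleftrightarrow> (\<forall>x. \<forall>u\<in>g x. P (x, u))" for g P
    by (auto simp: op_graph_def)
  have scale: "(\<forall>u\<in>op_scale (- 1) f x. P u) \<longleftrightarrow> (\<forall>u\<in>f x. P (- u))" for x P
    by (auto simp: op_scale_def)
  have sign: "(0 \<le> (y - x) * (- v - - u)) \<longleftrightarrow> (y - x) * (v - u) \<le> 0" for x y u v :: real
    using mult_minus_right[of "y - x" "v - u"] by simp
  show ?thesis
    unfolding nonincreasing_op_def nondecreasing_op_def graph scale prod.case sign by blast
qed

lemma nonincreasing_opD:
  "nonincreasing_op f \<Longrightarrow> u \<in> f x \<Longrightarrow> v \<in> f y \<Longrightarrow> (y - x) * (v - u) \<le> 0"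
  unfolding nonincreasing_op_iff by blast

lemma mult_nonpos_iff_between:
  "(t - a) * (t - c) \<le> 0 \<longleftrightarrow> min a c \<le> t \<and> t \<le> max a c" for t a c :: real
  by (auto simp: mult_le_0_iff)

text \<open>One-dimensional Minty argument: the point \<open>(t, t - x)\<close> is compatible with \<open>(a, u)\<close>
  iff \<open>t\<close> lies between \<open>a\<close> and \<open>u + x\<close>, and these intervals meet pairwise.\<close>

lemma nonincreasing_op_extension_point:
  assumes f: "nonincreasing_op f" and u0: "u0 \<in> f a0"
  shows "\<exists>t. \<forall>a. \<forall>u\<in>f a. (t - a) * (t - x - u) \<le> 0"
proof -
  \<comment> \<open>\<open>A\<close> collects the left endpoints of the intervals. Each lies below
    every right endpoint, so \<open>Sup A\<close> belongs to all of them: Helly's theorem on the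
    line.\<close>
  define A where "A = {min a (u + x) | a u. u \<in> f a}"
  have pair: "min a (u + x) \<le> max b (v + x)" if "u \<in> f a" "v \<in> f b" for a b u v
    using nonincreasing_opD[OF f that] by (auto simp: mult_le_0_iff)
  have ne: "A \<noteq> {}" using u0 by (auto simp: A_def)
  have bdd: "bdd_above A"
    using pair[OF _ u0] by (intro bdd_aboveI[of _ "max a0 (u0 + x)"]) (auto simp: A_def)
  have "(Sup A - a) * (Sup A - x - u) \<le> 0" if "u \<in> f a" for a u
  proof -
    have "min a (u + x) \<le> Sup A"
      using that by (intro cSup_upper bdd) (auto simp: A_def)
    moreover have "Sup A \<le> max a (u + x)"
      using pair[OF _ that] by (intro cSup_least ne) (auto simp: A_def)
    ultimately have "(Sup A - a) * (Sup A - (u + x)) \<le> 0"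
      by (simp only: mult_nonpos_iff_between)
    then show ?thesis by (simp add: algebra_simps)
  qed
  then show ?thesis by blast
qed

text \<open>Two solutions \<open>s\<close> and \<open>t\<close> differ by \<open>s - t\<close> both
  as arguments and in their values, so monotonicity makes the square of \<open>s - t\<close>
  nonpositive.\<close>

lemma resolvent_eqI:
  assumes f: "nonincreasing_op f" and y: "t - x \<in> f t"
  shows "resolvent f x = t"
proof -
  have "s = t" if "s - x \<in> f s" for s
  proof -
    have "(s - t) * (s - x - (t - x)) \<le> 0"
      by (rule nonincreasing_opD[OF f y that])
    then have "(s - t)\<^sup>2 \<le> 0" by (simp add: power2_eq_square)
    then show ?thesis by simp
  qed
  moreover have "resolvent_op f x = {s. s - x \<in> f s}"
    by (force simp: resolvent_op_def op_inv_def)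
  ultimately have "resolvent_op f x = {t}" using y by blast
  then show ?thesis by (simp add: resolvent_def)
qed

text \<open>Adding the point from the Minty argument keeps \<open>f\<close> nonincreasing, so by
  maximality it already lies in the graph.\<close>

lemma M_down_resolvent_exists:
  assumes "f \<in> M_down"
  shows "\<exists>t. t - x \<in> f t"
proof -
  have f: "nonincreasing_op f"
    and max: "\<And>g. nonincreasing_op g \<Longrightarrow> op_graph f \<subseteq> op_graph g \<Longrightarrow> op_graph g = op_graph f"
    using assms by (auto simp: M_down_def maximally_monotone_op_def monotone_op_def)
  \<comment> \<open>For an empty graph the condition on \<open>t\<close> is vacuous.\<close>
  have "\<exists>t. \<forall>a. \<forall>u\<in>f a. (t - a) * (t - x - u) \<le> 0"
    using nonincreasing_op_extension_point[OF f] by blast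
  then obtain t where t: "\<And>a u. u \<in> f a \<Longrightarrow> (t - a) * (t - x - u) \<le> 0" by blast
  define g where "g = f(t := insert (t - x) (f t))"
  have t': "(a - t) * (u - (t - x)) \<le> 0" if "u \<in> f a" for a u
  proof -
    have "(a - t) * (u - (t - x)) = (t - a) * (t - x - u)" by (simp add: algebra_simps)
    then show ?thesis using t[OF that] by simp
  qed
  have "nonincreasing_op g"
    unfolding nonincreasing_op_iff
  proof (intro allI ballI)
    fix a b u v
    assume uv: "u \<in> g a" "v \<in> g b"
    have "u \<in> f a \<or> a = t \<and> u = t - x" "v \<in> f b \<or> b = t \<and> v = t - x"
      using uv by (auto simp: g_def split: if_splits)
    then show "(b - a) * (v - u) \<le> 0"
      by (elim disjE conjE) (simp_all add: nonincreasing_opD[OF f] t t' del: mult_le_0_iff)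
  qed
  moreover have "op_graph f \<subseteq> op_graph g"
    by (auto simp: op_graph_def g_def)
  ultimately have "op_graph g = op_graph f" by (rule max)
  moreover have "(t, t - x) \<in> op_graph g" by (simp add: op_graph_def g_def)
  ultimately show ?thesis by (auto simp: op_graph_def)
qed

section \<open>Survival operators and tail bounds\<close>

context prob_space
begin

lemma prob_gt_antimono:
  fixes X :: "'a \<Rightarrow> real"
  assumes [measurable]: "X \<in> borel_measurable M" and "s \<le> t"
  shows "prob {\<omega> \<in> space M. X \<omega> > t} \<le> prob {\<omega> \<in> space M. X \<omega> > s}"
  using \<open>s \<le> t\<close> by (intro finite_measure_mono) auto

lemma prob_ge_le_gt:
  fixes X :: "'a \<Rightarrow> real"
  assumes [measurable]: "X \<in> borel_measurable M" and "s < t"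
  shows "prob {\<omega> \<in> space M. X \<omega> \<ge> t} \<le> prob {\<omega> \<in> space M. X \<omega> > s}"
  using \<open>s < t\<close> by (intro finite_measure_mono) auto

lemma nonincreasing_survival_op:
  assumes X: "X \<in> borel_measurable M"
  shows "nonincreasing_op (survival_op M X)"
  unfolding nonincreasing_op_iff
proof (intro allI ballI)
  fix s t u v
  assume uv: "u \<in> survival_op M X s" "v \<in> survival_op M X t"
  consider "s < t" | "s = t" | "t < s" by linarith
  then show "(t - s) * (v - u) \<le> 0"
    by cases (use uv prob_ge_le_gt[OF X, of s t] prob_ge_le_gt[OF X, of t s] in
      \<open>auto simp: survival_op_def mult_le_0_iff\<close>)
qed

text \<open>The compatible value \<open>t - x\<close> is squeezed between the one-sided limits at
  \<open>t\<close> of the tail function, which are the endpoints of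
  \<open>survival_op M X t\<close>.\<close>

lemma survival_op_resolvent_exists:
  assumes X[measurable]: "X \<in> borel_measurable M"
  shows "\<exists>t. t - x \<in> survival_op M X t"
proof -
  let ?G = "\<lambda>t. prob {\<omega> \<in> space M. X \<omega> > t}"
  let ?H = "\<lambda>t. prob {\<omega> \<in> space M. X \<omega> \<ge> t}"
  have GH: "?G t \<in> survival_op M X t" "?H t \<in> survival_op M X t" for t
    unfolding survival_op_def by (auto intro!: finite_measure_mono)
  obtain t where t: "\<And>a u. u \<in> survival_op M X a \<Longrightarrow> (t - a) * (t - x - u) \<le> 0"
    using nonincreasing_op_extension_point[OF nonincreasing_survival_op[OF X] GH(1)] by blast
  interpret D: real_distribution "distr M borel X"
    by (rule real_distribution_distr) simp
  have G: "?G s = 1 - cdf (distr M borel X) s" for s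
  proof -
    have "cdf (distr M borel X) s = prob {\<omega> \<in> space M. \<not> X \<omega> > s}"
      by (simp add: cdf_def measure_distr vimage_def Int_def not_less conj_commute)
    also have "\<dots> = 1 - ?G s" by (rule prob_neg) simp
    finally show ?thesis by simp
  qed
  have H: "?H s = 1 - measure (distr M borel X) {..<s}" for s
  proof -
    have "measure (distr M borel X) {..<s} = prob {\<omega> \<in> space M. \<not> X \<omega> \<ge> s}"
      by (simp add: measure_distr vimage_def Int_def not_le conj_commute)
    also have "\<dots> = 1 - ?H s" by (rule prob_neg) simp
    finally show ?thesis by simp
  qed
  have "(?G \<longlongrightarrow> ?G t) (at_right t)"
    using D.cdf_is_right_cont[of t] unfolding G continuous_within by (intro tendsto_intros)
  \<comment> \<open>For \<open>s > t\<close>, compatibility with \<open>(s, ?G s)\<close> reads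
    \<open>?G s \<le> t - x\<close>.\<close>
  moreover have "\<forall>\<^sub>F s in at_right t. ?G s \<le> t - x"
    using eventually_at_right_less[of t]
  proof eventually_elim
    case (elim s)
    then show ?case using t[OF GH(1), of s] by (auto simp: mult_le_0_iff)
  qed
  ultimately have 1: "?G t \<le> t - x"
    by (rule tendsto_upperbound) simp
  \<comment> \<open>The left limit is \<open>?H t\<close>, which counts a possible atom at
    \<open>t\<close>; for \<open>s < t\<close> the compatibility inequality is reversed.\<close>
  have "(?G \<longlongrightarrow> ?H t) (at_left t)"
    using D.cdf_at_left[of t] unfolding G H by (intro tendsto_intros)
  moreover have "\<forall>\<^sub>F s in at_left t. t - x \<le> ?G s"
    using eventually_at_left_real[of "t - 1" t, simplified]
  proof eventually_elim
    case (elim s)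
    then show ?case using t[OF GH(1), of s] by (auto simp: mult_le_0_iff)
  qed
  ultimately have 2: "t - x \<le> ?H t"
    by (rule tendsto_lowerbound) simp
  show ?thesis using 1 2 by (auto simp: survival_op_def)
qed

text \<open>The resolvents are compared at \<open>t - u\<close>, where that of
  \<open>\<gamma>\<close> is \<open>t\<close>. If that of the survival operator is
  \<open>s \<le> t\<close>, the tail at \<open>t\<close> is at most the tail at \<open>s\<close>,
  hence at most \<open>u + (s - t) \<le> u\<close>.\<close>

lemma op_le_survival_imp_tail:
  assumes X: "X \<in> borel_measurable M" and \<gamma>: "nonincreasing_op \<gamma>"
    and le: "op_le (survival_op M X) \<gamma>" and u: "u \<in> \<gamma> t"
  shows "prob {\<omega> \<in> space M. X \<omega> > t} \<le> u"
proof -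
  obtain s where s: "s - (t - u) \<in> survival_op M X s"
    using survival_op_resolvent_exists[OF X] by blast
  have "resolvent (survival_op M X) (t - u) = s"
    by (rule resolvent_eqI[OF nonincreasing_survival_op[OF X] s])
  moreover have "resolvent \<gamma> (t - u) = t"
    by (rule resolvent_eqI[OF \<gamma>]) (simp add: u)
  ultimately have "s \<le> t" using le unfolding op_le_def by metis
  moreover have "prob {\<omega> \<in> space M. X \<omega> > s} \<le> s - (t - u)"
    using s by (simp add: survival_op_def)
  ultimately show ?thesis using prob_gt_antimono[OF X \<open>s \<le> t\<close>] by linarith
qed

text \<open>In the resolvent order, \<open>t < s\<close> would give
  \<open>s - x \<le> P(X \<ge> s) \<le> P(X > t) \<le> t - x\<close>. In the other case the tail
  bound is the definition itself.\<close>

lemma tail_imp_survival_le: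
  assumes X: "X \<in> borel_measurable M"
    and tail: "\<And>t u. u \<in> \<gamma> t \<Longrightarrow> prob {\<omega> \<in> space M. X \<omega> > t} \<le> u"
  shows "survival_le M X \<gamma>"
proof (cases "\<gamma> \<in> M_down")
  case True
  then have \<gamma>: "nonincreasing_op \<gamma>" by (simp add: M_down_def)
  have "resolvent (survival_op M X) x \<le> resolvent \<gamma> x" for x
  proof -
    obtain s where s: "s - x \<in> survival_op M X s"
      using survival_op_resolvent_exists[OF X] by blast
    obtain t where t: "t - x \<in> \<gamma> t"
      using M_down_resolvent_exists[OF True] by blast
    have "s \<le> t"
    proof (rule ccontr)
      assume "\<not> s \<le> t"
      then show False
        using prob_ge_le_gt[OF X, of t s] tail[OF t] s by (simp add: survival_op_def)
    qed
    then show ?thesis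
      using resolvent_eqI[OF nonincreasing_survival_op[OF X] s] resolvent_eqI[OF \<gamma> t] by simp
  qed
  then show ?thesis using True by (simp add: survival_le_def op_le_def)
next
  case False
  then show ?thesis using tail by (simp add: survival_le_def)
qed

end

section \<open>Membership in parallel products\<close>

lemma mem_par_prod_iff:
  "u \<in> par_prod f g t \<longleftrightarrow> (\<exists>a b. u \<in> f a \<and> u \<in> g b \<and> t = a * b)"
  by (auto simp: par_prod_def op_inv_def op_prod_def)

lemma mem_foldl_par_prodD:
  fixes n :: nat
  assumes "u \<in> foldl par_prod \<alpha> (map \<beta> [1..<Suc n]) t"
  shows "\<exists>a b. u \<in> \<alpha> a \<and> (\<forall>k\<in>{1..n}. u \<in> \<beta> k (b k)) \<and> t = a * (\<Prod>k=1..n. b k)"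
  using assms
proof (induction n arbitrary: t)
  case 0
  then show ?case by auto
next
  case (Suc n)
  \<comment> \<open>The fold associates to the left, so the last operator is the outermost
    factor.\<close>
  have "foldl par_prod \<alpha> (map \<beta> [1..<Suc (Suc n)]) =
      par_prod (foldl par_prod \<alpha> (map \<beta> [1..<Suc n])) (\<beta> (Suc n))"
    by simp
  then obtain s c where s: "u \<in> foldl par_prod \<alpha> (map \<beta> [1..<Suc n]) s"
    and c: "u \<in> \<beta> (Suc n) c" and t: "t = s * c"
    using Suc.prems by (auto simp only: mem_par_prod_iff)
  from Suc.IH[OF s] obtain a b where
    ab: "u \<in> \<alpha> a" "\<forall>k\<in>{1..n}. u \<in> \<beta> k (b k)" "s = a * (\<Prod>k=1..n. b k)" by blast
  \<comment> \<open>The induction hypothesis constrains \<open>b\<close> only on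
    \<open>{1..n}\<close>, so its value at \<open>Suc n\<close> is free to become
    \<open>c\<close>.\<close>
  have "(\<Prod>k=1..n. (b(Suc n := c)) k) = (\<Prod>k=1..n. b k)"
    by (intro prod.cong) auto
  then have "t = a * (\<Prod>k=1..Suc n. (b(Suc n := c)) k)"
    using ab(3) t by simp
  moreover have "\<forall>k\<in>{1..Suc n}. u \<in> \<beta> k ((b(Suc n := c)) k)"
    using ab(2) c by auto
  ultimately show ?case using ab(1) by blast
qed

section \<open>Infimal convolution and convex Lipschitz extension\<close>

definition inf_conv_norm :: "real \<Rightarrow> ('e::real_normed_vector \<Rightarrow> real) \<Rightarrow> 'e \<Rightarrow> real" where
  "inf_conv_norm L \<Phi> z = (INF w. \<Phi> w + L * norm (z - w))"

text \<open>One cone below \<open>\<Phi>\<close> with apex at \<open>z0\<close> bounds all the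
  infima from below, by the triangle inequality. Without such a bound a real-valued
  \<open>INF\<close> carries no information.\<close>

locale norm_minorized =
  fixes L :: real and \<Phi> :: "'e::real_normed_vector \<Rightarrow> real" and z0 :: 'e
  assumes L_nonneg: "0 \<le> L"
    and minorized: "\<And>w. \<Phi> z0 - L * norm (w - z0) \<le> \<Phi> w"
begin

lemma bdd_below_inf_conv: "bdd_below (range (\<lambda>w. \<Phi> w + L * norm (z - w)))"
proof (rule bdd_belowI2)
  fix w
  have "norm (w - z0) \<le> norm (z - z0) + norm (z - w)"
    using norm_triangle_ineq[of "z - z0" "w - z"] by (simp add: norm_minus_commute)
  then have "L * norm (w - z0) \<le> L * (norm (z - z0) + norm (z - w))"
    by (intro mult_left_mono L_nonneg)
  then show "\<Phi> z0 - L * norm (z - z0) \<le> \<Phi> w + L * norm (z - w)"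
    using minorized[of w] by (simp add: algebra_simps)
qed

lemma inf_conv_norm_le: "inf_conv_norm L \<Phi> z \<le> \<Phi> w + L * norm (z - w)"
  unfolding inf_conv_norm_def by (rule cINF_lower[OF bdd_below_inf_conv]) simp

lemma inf_conv_norm_approx:
  assumes "0 < e"
  obtains w where "\<Phi> w + L * norm (z - w) < inf_conv_norm L \<Phi> z + e"
proof -
  have "(INF w. \<Phi> w + L * norm (z - w)) < inf_conv_norm L \<Phi> z + e"
    using assms by (simp add: inf_conv_norm_def)
  then show ?thesis
    using that by (subst (asm) cINF_less_iff[OF _ bdd_below_inf_conv]) auto
qed

text \<open>A cone below \<open>\<Phi>\<close> with apex at \<open>z\<close> itself says that
  \<open>w = z\<close> attains the infimum.\<close>

lemma inf_conv_norm_eq: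
  assumes "\<And>w. \<Phi> z - L * norm (w - z) \<le> \<Phi> w"
  shows "inf_conv_norm L \<Phi> z = \<Phi> z"
proof (rule antisym)
  show "inf_conv_norm L \<Phi> z \<le> \<Phi> z" using inf_conv_norm_le[of z z] by simp
  show "\<Phi> z \<le> inf_conv_norm L \<Phi> z"
    unfolding inf_conv_norm_def
    by (rule cINF_greatest) (use assms in \<open>auto simp: norm_minus_commute algebra_simps\<close>)
qed

text \<open>A near-minimizer for \<open>z\<close> serves as a competitor for
  \<open>y\<close>.\<close>

lemma inf_conv_norm_diff_le:
  "inf_conv_norm L \<Phi> y - inf_conv_norm L \<Phi> z \<le> L * norm (y - z)"
proof -
  have "inf_conv_norm L \<Phi> y \<le> inf_conv_norm L \<Phi> z + L * norm (y - z) + e" if "0 < e" for e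
  proof -
    obtain w where w: "\<Phi> w + L * norm (z - w) < inf_conv_norm L \<Phi> z + e"
      using inf_conv_norm_approx[OF \<open>0 < e\<close>] .
    have "norm (y - w) \<le> norm (y - z) + norm (z - w)"
      using norm_triangle_ineq[of "y - z" "z - w"] by simp
    then have "L * norm (y - w) \<le> L * (norm (y - z) + norm (z - w))"
      by (intro mult_left_mono L_nonneg)
    then show ?thesis
      using w inf_conv_norm_le[of y w] by (simp add: algebra_simps)
  qed
  then have "inf_conv_norm L \<Phi> y \<le> inf_conv_norm L \<Phi> z + L * norm (y - z)"
    by (rule field_le_epsilon)
  then show ?thesis by simp
qed

lemma lipschitz_inf_conv_norm: "L-lipschitz_on UNIV (inf_conv_norm L \<Phi>)"
proof (rule lipschitz_onI)
  fix y z
  show "dist (inf_conv_norm L \<Phi> y) (inf_conv_norm L \<Phi> z) \<le> L * dist y z"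
    using inf_conv_norm_diff_le[of y z] inf_conv_norm_diff_le[of z y]
    by (simp add: dist_norm norm_minus_commute abs_le_iff)
qed (rule L_nonneg)

text \<open>The minimized expression is jointly convex in the point and in \<open>w\<close>, so the
  convex combination of near-minimizers for \<open>x\<close> and \<open>y\<close> is a good
  competitor at the combined point.\<close>

lemma convex_inf_conv_norm:
  assumes \<Phi>: "convex_on UNIV \<Phi>"
  shows "convex_on UNIV (inf_conv_norm L \<Phi>)"
proof (rule convex_onI)
  fix t :: real and x y :: 'e
  let ?g = "inf_conv_norm L \<Phi>"
  assume t: "0 < t" "t < 1"
  have "?g ((1 - t) *\<^sub>R x + t *\<^sub>R y) \<le> (1 - t) * ?g x + t * ?g y + e" if "0 < e" for e
  proof -
    obtain v where v: "\<Phi> v + L * norm (x - v) < ?g x + e"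
      using inf_conv_norm_approx[OF \<open>0 < e\<close>] .
    obtain w where w: "\<Phi> w + L * norm (y - w) < ?g y + e"
      using inf_conv_norm_approx[OF \<open>0 < e\<close>] .
    let ?z = "(1 - t) *\<^sub>R x + t *\<^sub>R y" and ?m = "(1 - t) *\<^sub>R v + t *\<^sub>R w"
    have "norm (?z - ?m) = norm ((1 - t) *\<^sub>R (x - v) + t *\<^sub>R (y - w))"
      by (simp add: algebra_simps)
    also have "\<dots> \<le> (1 - t) * norm (x - v) + t * norm (y - w)"
      using norm_triangle_ineq[of "(1 - t) *\<^sub>R (x - v)" "t *\<^sub>R (y - w)"] t by simp
    finally have "L * norm (?z - ?m) \<le> L * ((1 - t) * norm (x - v) + t * norm (y - w))"
      by (intro mult_left_mono L_nonneg)
    moreover have "\<Phi> ?m \<le> (1 - t) * \<Phi> v + t * \<Phi> w"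
      using convex_onD[OF \<Phi>, of t v w] t by simp
    moreover have "(1 - t) * (\<Phi> v + L * norm (x - v)) \<le> (1 - t) * (?g x + e)"
      using v t by (intro mult_left_mono) auto
    moreover have "t * (\<Phi> w + L * norm (y - w)) \<le> t * (?g y + e)"
      using w t by (intro mult_left_mono) auto
    ultimately show ?thesis
      using inf_conv_norm_le[of ?z ?m] by (simp add: algebra_simps)
  qed
  then show "?g ((1 - t) *\<^sub>R x + t *\<^sub>R y) \<le> (1 - t) * ?g x + t * ?g y"
    by (rule field_le_epsilon)
qed simp

end

text \<open>Only the value of \<open>K\<close> at \<open>z\<close> survives, because the difference quotients of \<open>\<Phi>\<close> along a
  segment starting at \<open>z\<close> are smallest near \<open>z\<close>.\<close>

lemma convex_local_lipschitz_minorant: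
  fixes \<Phi> K :: "'e::real_normed_vector \<Rightarrow> real"
  assumes \<Phi>: "convex_on UNIV \<Phi>"
    and K: "isCont K z" and lip: "\<And>w. \<bar>\<Phi> z - \<Phi> w\<bar> \<le> K w * norm (z - w)"
  shows "\<Phi> z - K z * norm (w - z) \<le> \<Phi> w"
proof -
  let ?p = "\<lambda>t::real. (1 - t) *\<^sub>R z + t *\<^sub>R w"
  have "(?p \<longlongrightarrow> ?p 0) (at_right 0)"
    by (intro tendsto_intros)
  then have "((\<lambda>t. K (?p t)) \<longlongrightarrow> K z) (at_right 0)"
    using isCont_tendsto_compose[OF K] by simp
  then have "((\<lambda>t. \<Phi> z - K (?p t) * norm (w - z)) \<longlongrightarrow> \<Phi> z - K z * norm (w - z)) (at_right 0)"
    by (intro tendsto_intros)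
  moreover have "\<forall>\<^sub>F t in at_right 0. \<Phi> z - K (?p t) * norm (w - z) \<le> \<Phi> w"
    using eventually_at_right_real[of 0 "1::real", simplified]
  proof eventually_elim
    case (elim t)
    have "z - ?p t = t *\<^sub>R (z - w)" by (simp add: algebra_simps)
    then have "norm (z - ?p t) = t * norm (w - z)"
      using elim by (simp add: norm_minus_commute)
    then have "\<Phi> z - K (?p t) * (t * norm (w - z)) \<le> \<Phi> (?p t)"
      using lip[of "?p t"] by (simp add: abs_le_iff)
    also have "\<dots> \<le> (1 - t) * \<Phi> z + t * \<Phi> w"
      using convex_onD[OF \<Phi>, of t z w] elim by simp
    finally have "t * (\<Phi> z - K (?p t) * norm (w - z)) \<le> t * \<Phi> w"
      by (simp add: algebra_simps)
    then show ?case using elim by simp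
  qed
  ultimately show ?thesis
    by (rule tendsto_upperbound) simp
qed

text \<open>The infimal convolution divided by \<open>L\<close> is the required \<open>h\<close>;
  only the degenerate cases need another choice.\<close>

lemma convex_lipschitz_extension:
  fixes \<Phi> :: "'e::real_normed_vector \<Rightarrow> real"
  assumes \<Phi>: "convex_on UNIV \<Phi>" and L: "0 \<le> L"
    and C: "\<And>z w. z \<in> C \<Longrightarrow> \<Phi> z - L * norm (w - z) \<le> \<Phi> w"
  shows "\<exists>h. 1-lipschitz_on UNIV h \<and> convex_on UNIV h \<and>
           (\<forall>z\<in>C. \<forall>w\<in>C. \<Phi> z - \<Phi> w = L * (h z - h w))"
proof (cases "L = 0 \<or> C = {}")
  case True
  \<comment> \<open>For \<open>L = 0\<close> the cones are flat, so \<open>\<Phi>\<close> is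
    constant on \<open>C\<close> and the zero function suffices.\<close>
  have "1-lipschitz_on UNIV (\<lambda>_::'e. 0::real)" "convex_on UNIV (\<lambda>_::'e. 0::real)"
    by (auto simp: lipschitz_on_def convex_on_def)
  moreover have "\<Phi> z - \<Phi> w = L * (0 - 0)" if "z \<in> C" "w \<in> C" for z w
    using True that C[of z w] C[of w z] by auto
  ultimately show ?thesis by blast
next
  case False
  then obtain z0 where z0: "z0 \<in> C" by blast
  interpret norm_minorized L \<Phi> z0
    by unfold_locales (use L C[OF z0] in auto)
  have L0: "0 < L" using False L by simp
  let ?h = "\<lambda>z. inverse L * inf_conv_norm L \<Phi> z"
  have "1-lipschitz_on UNIV ?h"
    using lipschitz_on_cmult_real[OF lipschitz_inf_conv_norm, of "inverse L"] L0 by simp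
  moreover have "convex_on UNIV ?h"
    using convex_on_cmul[OF _ convex_inf_conv_norm[OF \<Phi>], of "inverse L"] L0 by simp
  moreover have "\<Phi> z - \<Phi> w = L * (?h z - ?h w)" if "z \<in> C" "w \<in> C" for z w
    using inf_conv_norm_eq[OF C] that L0 by (simp add: field_simps)
  ultimately show ?thesis by blast
qed

section \<open>Tail bound for the increments of \<Phi>\<close>

theorem theorem2p26:
  fixes M :: "'w measure"
    and Z :: "'w \<Rightarrow> 'e::euclidean_space"
    and \<Lambda> :: "nat \<Rightarrow> 'e \<Rightarrow> real"
    and n :: nat
    and \<alpha> :: operator and \<beta> :: "nat \<Rightarrow> operator"
    and \<Phi> :: "'e \<Rightarrow> real"
  assumes "prob_space M"
    and "Z \<in> borel_measurable M"
    and "\<And>k. k \<in> {1..n} \<Longrightarrow> continuous_on UNIV (\<Lambda> k)"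
    and "\<And>k z. k \<in> {1..n} \<Longrightarrow> \<Lambda> k z \<ge> 0"
    and "\<alpha> \<in> M_prob"
    and "\<And>k. k \<in> {1..n} \<Longrightarrow> \<beta> k \<in> M_prob"
    and "\<And>f Z'. 1-lipschitz_on UNIV f \<Longrightarrow> convex_on UNIV f \<Longrightarrow> independent_copy M Z Z' \<Longrightarrow>
           op_le (survival_op M (\<lambda>\<omega>. \<bar>f (Z \<omega>) - f (Z' \<omega>)\<bar>)) \<alpha>"
    and "\<And>k. k \<in> {1..n} \<Longrightarrow> op_le (survival_op M (\<lambda>\<omega>. \<Lambda> k (Z \<omega>))) (\<beta> k)"
    and "convex_on UNIV \<Phi>"
    and "\<And>z z'. \<bar>\<Phi> z - \<Phi> z'\<bar> \<le> (\<Prod>k=1..n. max (\<Lambda> k z) (\<Lambda> k z')) * norm (z - z')"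
  shows "\<forall>Z'. independent_copy M Z Z' \<longrightarrow>
           survival_le M (\<lambda>\<omega>. \<bar>\<Phi> (Z \<omega>) - \<Phi> (Z' \<omega>)\<bar>)
             (op_scale (2 * real n + 1) (foldl par_prod \<alpha> (map \<beta> [1..<Suc n])))"
proof (intro allI impI)
  fix Z'
  assume copy: "independent_copy M Z Z'"
  interpret prob_space M by fact
  note Z[measurable] = assms(2)
  have Z'[measurable]: "Z' \<in> borel_measurable M" and distr: "distr M borel Z' = distr M borel Z"
    using copy by (auto simp: independent_copy_def)
  have [measurable]: "\<Phi> \<in> borel_measurable borel"
    using convex_on_continuous[OF open_UNIV assms(9)] by (rule borel_measurable_continuous_onI)
  have \<Lambda>_meas: "\<Lambda> k \<in> borel_measurable borel" if "k \<in> {1..n}" for k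
    using assms(3)[OF that] by (rule borel_measurable_continuous_onI)
  show "survival_le M (\<lambda>\<omega>. \<bar>\<Phi> (Z \<omega>) - \<Phi> (Z' \<omega>)\<bar>)
          (op_scale (2 * real n + 1) (foldl par_prod \<alpha> (map \<beta> [1..<Suc n])))"
  proof (rule tail_imp_survival_le)
    fix t v
    assume "v \<in> op_scale (2 * real n + 1) (foldl par_prod \<alpha> (map \<beta> [1..<Suc n])) t"
    then obtain u where v: "v = (2 * real n + 1) * u"
      and "u \<in> foldl par_prod \<alpha> (map \<beta> [1..<Suc n]) t"
      unfolding op_scale_def by blast
    from mem_foldl_par_prodD[OF this(2)] obtain a b where a: "u \<in> \<alpha> a"
      and b: "\<And>k. k \<in> {1..n} \<Longrightarrow> u \<in> \<beta> k (b k)" and t: "t = a * (\<Prod>k=1..n. b k)"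
      by blast
    define L where "L = (\<Prod>k=1..n. b k)"
    have t_eq: "t = L * a" unfolding t L_def by (rule mult.commute)
    define C where "C = {z. \<forall>k\<in>{1..n}. \<Lambda> k z \<le> b k}"
    \<comment> \<open>The domain of each \<open>\<beta> k\<close> lies in the nonnegative
      reals.\<close>
    have "0 \<le> b k" if "k \<in> {1..n}" for k
      using assms(6)[OF that] b[OF that] by (auto simp: M_prob_def op_Dom_def)
    then have L0: "0 \<le> L" unfolding L_def by (intro prod_nonneg) auto
    have minorant: "\<Phi> z - L * norm (w - z) \<le> \<Phi> w" if z: "z \<in> C" for z w
    proof -
      \<comment> \<open>At \<open>w = z\<close> each maximum collapses to
        \<open>\<Lambda> k z\<close>, which is at most \<open>b k\<close> on
        \<open>C\<close>.\<close>
      let ?K = "\<lambda>w. \<Prod>k=1..n. max (\<Lambda> k z) (\<Lambda> k w)"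
      have "continuous_on UNIV ?K"
        using assms(3) by (intro continuous_intros) auto
      then have "isCont ?K z" by (simp add: continuous_on_eq_continuous_at)
      then have "\<Phi> z - ?K z * norm (w - z) \<le> \<Phi> w"
        by (rule convex_local_lipschitz_minorant[OF assms(9)]) (rule assms(10))
      moreover have "?K z \<le> L"
        unfolding L_def using z assms(4) by (intro prod_mono) (auto simp: C_def)
      then have "?K z * norm (w - z) \<le> L * norm (w - z)"
        by (rule mult_right_mono) simp
      ultimately show ?thesis by linarith
    qed
    have "\<exists>h. 1-lipschitz_on UNIV h \<and> convex_on UNIV h \<and>
            (\<forall>z\<in>C. \<forall>w\<in>C. \<Phi> z - \<Phi> w = L * (h z - h w))"
      by (rule convex_lipschitz_extension[OF assms(9) L0 minorant])
    then obtain h where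
      h: "1-lipschitz_on UNIV h" "convex_on UNIV h"
      and h_eq: "\<forall>z\<in>C. \<forall>w\<in>C. \<Phi> z - \<Phi> w = L * (h z - h w)"
      by (elim exE conjE) (rule that)
    have [measurable]: "h \<in> borel_measurable borel"
      using lipschitz_on_continuous_on[OF h(1)] by (rule borel_measurable_continuous_onI)
    define F where "F = {\<omega> \<in> space M. \<bar>h (Z \<omega>) - h (Z' \<omega>)\<bar> > a}"
    define B where "B k = {\<omega> \<in> space M. \<Lambda> k (Z \<omega>) > b k}" for k
    define B' where "B' k = {\<omega> \<in> space M. \<Lambda> k (Z' \<omega>) > b k}" for k
    have "nonincreasing_op \<alpha>" using assms(5) by (simp add: M_prob_def M_down_def)
    \<comment> \<open>The bound by \<open>\<alpha>\<close> holds for the whole class of convex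
      1-Lipschitz functions, hence for this \<open>h\<close>, although it is chosen after
      \<open>b\<close>.\<close>
    then have F: "prob F \<le> u"
      unfolding F_def by (intro op_le_survival_imp_tail[OF _ _ assms(7)[OF h copy] a]) measurable
    have F_ev: "F \<in> events" unfolding F_def by measurable
    have B: "prob (B k) \<le> u" "B k \<in> events" and B': "prob (B' k) \<le> u" "B' k \<in> events"
      if k: "k \<in> {1..n}" for k
    proof -
      note [measurable] = \<Lambda>_meas[OF k]
      show "B k \<in> events" "B' k \<in> events" by (auto simp: B_def B'_def)
      show *: "prob (B k) \<le> u"
        unfolding B_def
      proof (rule op_le_survival_imp_tail[OF _ _ assms(8)[OF k] b[OF k]])
        show "nonincreasing_op (\<beta> k)" using assms(6)[OF k] by (simp add: M_prob_def M_down_def)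
      qed measurable
      \<comment> \<open>The bound passes from \<open>Z\<close> to \<open>Z'\<close> through their
        common law.\<close>
      have "prob (B k) = measure (distr M borel Z) {z. \<Lambda> k z > b k}"
        by (simp add: measure_distr B_def vimage_def Int_def conj_commute)
      also have "\<dots> = measure (distr M borel Z') {z. \<Lambda> k z > b k}"
        by (simp only: distr)
      also have "\<dots> = prob (B' k)"
        by (simp add: measure_distr B'_def vimage_def Int_def conj_commute)
      finally show "prob (B' k) \<le> u" using * by simp
    qed
    have sub: "{\<omega> \<in> space M. \<bar>\<Phi> (Z \<omega>) - \<Phi> (Z' \<omega>)\<bar> > t} \<subseteq> F \<union> (\<Union>k\<in>{1..n}. B k \<union> B' k)"
    proof
      fix \<omega>
      assume \<omega>: "\<omega> \<in> {\<omega> \<in> space M. \<bar>\<Phi> (Z \<omega>) - \<Phi> (Z' \<omega>)\<bar> > t}"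
      show "\<omega> \<in> F \<union> (\<Union>k\<in>{1..n}. B k \<union> B' k)"
      proof (cases "Z \<omega> \<in> C \<and> Z' \<omega> \<in> C")
        case True
        then have "L * a < L * \<bar>h (Z \<omega>) - h (Z' \<omega>)\<bar>"
          using \<omega> h_eq L0 by (simp add: t_eq abs_mult)
        \<comment> \<open>If \<open>L = 0\<close>, the preceding strict inequality is already
          absurd, so cancelling \<open>L\<close> is safe.\<close>
        then have "a < \<bar>h (Z \<omega>) - h (Z' \<omega>)\<bar>"
          using L0 by (simp add: mult_less_cancel_left)
        then show ?thesis using \<omega> by (simp add: F_def)
      next
        case False
        then show ?thesis using \<omega> by (auto simp: C_def B_def B'_def not_le)
      qed
    qed
    have "prob {\<omega> \<in> space M. \<bar>\<Phi> (Z \<omega>) - \<Phi> (Z' \<omega>)\<bar> > t}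
        \<le> prob (F \<union> (\<Union>k\<in>{1..n}. B k \<union> B' k))"
      using F_ev B(2) B'(2) by (intro finite_measure_mono[OF sub]) auto
    also have "\<dots> \<le> prob F + prob (\<Union>k\<in>{1..n}. B k \<union> B' k)"
      using F_ev B(2) B'(2) by (intro measure_Un_le) auto
    also have "\<dots> \<le> prob F + (\<Sum>k\<in>{1..n}. prob (B k \<union> B' k))"
      using B(2) B'(2) by (intro add_left_mono finite_measure_subadditive_finite) auto
    \<comment> \<open>One \<open>u\<close> comes from \<open>F\<close> and two from each
      \<open>k\<close>, whence the factor \<open>2 * n + 1\<close>.\<close>
    also have "\<dots> \<le> u + (\<Sum>k\<in>{1..n}. 2 * u)"
    proof (intro add_mono sum_mono F)
      fix k assume k: "k \<in> {1..n}"
      show "prob (B k \<union> B' k) \<le> 2 * u"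
        using measure_Un_le[OF B(2)[OF k] B'(2)[OF k]] B(1)[OF k] B'(1)[OF k]
        by linarith
    qed
    also have "\<dots> = v" by (simp add: v algebra_simps)
    finally show "prob {\<omega> \<in> space M. \<bar>\<Phi> (Z \<omega>) - \<Phi> (Z' \<omega>)\<bar> > t} \<le> v" .
  qed simp
qed

end
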